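(* Let $A$ be a finite set, let $k>1$ be an integer, and let $\mathcal{M}_k$ be the set of all clones on $A$ that contain a $k$-edge operation. Then: (1) for every $\mathcal{C}\in\mathcal{M}_k$ there is a finitary relation $R$ on $A$ with $\mathcal{C}=\mathrm{Pol}(A,\{R\})$; (2) there is no infinite strictly descending chain in $(\mathcal{M}_k,\subseteq)$; (3) $\mathcal{M}_k$ is finite or countably infinite.
   Context: A clone on $A$ is a set of finitary operations (of positive arity) on $A$ closed under composition and containing all projections. A $k$-edge operation ($k\ge2$) is $t:A^{k+1}\to A$ with $t(y,y,x,\dots,x)=t(y,x,y,x,\dots,x)=x$ and $t(x,\dots,x,y,x,\dots,x)=x$ ($y$ in position $i$) for each $i\in\{4,\dots,k+1\}$, for all $x,y\in A$ (for $k=2$ this means $m(x,y,z):=t(y,x,z)$ is a Malcev operation, $m(x,y,y)=m(y,y,x)=x$). A finitary relation on $A$ is a subset $R\subseteq A^I$ for a finite set $I$; an operation preserves $R$ if $R$ is closed under it coordinatewise. For a set $S$ of finitary relations, $\mathrm{Pol}(A,S)$ is the set of all finitary operations on $A$ preserving every relation in $S$. *)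

theory Defs
  imports Main "HOL-Library.Countable_Set"
begin

text \<open>Tuples in A^n are lists of length n with entries in A.
An n-ary operation on A (n > 0) is a pair (n, f) with f :: 'a list => 'a,
mapping A^n into A and canonically equal to undefined outside A^n.\<close>

definition tuples :: "'a set \<Rightarrow> nat \<Rightarrow> 'a list set" where
  "tuples A n = {xs. length xs = n \<and> set xs \<subseteq> A}"

definition is_op :: "'a set \<Rightarrow> nat \<Rightarrow> ('a list \<Rightarrow> 'a) \<Rightarrow> bool" where
  "is_op A n f \<longleftrightarrow> 0 < n \<and> (\<forall>xs \<in> tuples A n. f xs \<in> A)
                     \<and> (\<forall>xs. xs \<notin> tuples A n \<longrightarrow> f xs = undefined)"

definition Ops :: "'a set \<Rightarrow> (nat \<times> ('a list \<Rightarrow> 'a)) set" where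
  "Ops A = {(n, f). is_op A n f}"

definition proj :: "'a set \<Rightarrow> nat \<Rightarrow> nat \<Rightarrow> nat \<times> ('a list \<Rightarrow> 'a)" where
  "proj A n i = (n, \<lambda>xs. if xs \<in> tuples A n then xs ! i else undefined)"

definition compose :: "'a set \<Rightarrow> ('a list \<Rightarrow> 'a) \<Rightarrow> nat \<Rightarrow> ('a list \<Rightarrow> 'a) list
                        \<Rightarrow> nat \<times> ('a list \<Rightarrow> 'a)" where
  "compose A f m gs = (m, \<lambda>xs. if xs \<in> tuples A m then f (map (\<lambda>g. g xs) gs) else undefined)"

definition clone :: "'a set \<Rightarrow> (nat \<times> ('a list \<Rightarrow> 'a)) set \<Rightarrow> bool" where
  "clone A C \<longleftrightarrow> C \<subseteq> Ops A
     \<and> (\<forall>n i. 0 < n \<and> i < n \<longrightarrow> proj A n i \<in> C)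
     \<and> (\<forall>n f m gs. (n, f) \<in> C \<and> length gs = n \<and> (\<forall>g \<in> set gs. (m, g) \<in> C)
                   \<longrightarrow> compose A f m gs \<in> C)"

text \<open>k-edge operation (arity k+1); positions are 1-based in the paper.\<close>
definition edge_op :: "'a set \<Rightarrow> nat \<Rightarrow> ('a list \<Rightarrow> 'a) \<Rightarrow> bool" where
  "edge_op A k t \<longleftrightarrow> (\<forall>x \<in> A. \<forall>y \<in> A.
       t (y # y # replicate (k - 1) x) = x
     \<and> t (y # x # y # replicate (k - 2) x) = x
     \<and> (\<forall>i \<in> {4..k+1}. t ((replicate (k + 1) x)[i - 1 := y]) = x))"

definition is_rel :: "'a set \<Rightarrow> nat \<Rightarrow> 'a list set \<Rightarrow> bool" where
  "is_rel A m R \<longleftrightarrow> R \<subseteq> tuples A m"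

definition preserves :: "nat \<Rightarrow> ('a list \<Rightarrow> 'a) \<Rightarrow> nat \<Rightarrow> 'a list set \<Rightarrow> bool" where
  "preserves n f m R \<longleftrightarrow> (\<forall>rs. length rs = n \<and> set rs \<subseteq> R \<longrightarrow>
       map (\<lambda>j. f (map (\<lambda>r. r ! j) rs)) [0..<m] \<in> R)"

definition Pol :: "'a set \<Rightarrow> (nat \<times> 'a list set) set \<Rightarrow> (nat \<times> ('a list \<Rightarrow> 'a)) set" where
  "Pol A S = {(n, f) \<in> Ops A. \<forall>(m, R) \<in> S. preserves n f m R}"

definition clones_with_edge :: "'a set \<Rightarrow> nat \<Rightarrow> (nat \<times> ('a list \<Rightarrow> 'a)) set set" where
  "clones_with_edge A k = {C. clone A C \<and> (\<exists>t. (k + 1, t) \<in> C \<and> edge_op A k t)}"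

end

theory Submission
  imports Defs "HOL-Library.Sublist" "HOL-Library.List_Lexorder"
begin

text \<open>Order \<open>A\<^sup>n\<close> lexicographically. A clone \<open>C\<close> has the fork \<open>(a, b)\<close> at a word \<open>w\<close> if two of its operations
agree on all tuples below \<open>w\<close> and take the values \<open>a\<close> and \<open>b\<close> at \<open>w\<close>. In the presence of a \<open>k\<close>-edge operation,
a clone inside a given larger clone is determined by its forks together with its operations of one fixed
arity, which decide what can be interpolated at fewer than \<open>k\<close> points. Substituting variables shows that forks
are inherited downwards along an embedding order on words, and by Higman's lemma this order has no infinite
bad sequence; hence strictly descending chains are finite. A clone \<open>C\<close> is the intersection of the descending
clones of operations preserving the \<open>n\<close>-ary part of \<open>C\<close>, and since this chain becomes stationary, one finitary
relation suffices. There are only countably many finitary relations.\<close>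

section \<open>Higman's lemma over a finite alphabet\<close>

text \<open>Nash-Williams' argument: infinitely many words of a minimal bad sequence share their
  first letter, and deleting it from them yields a smaller bad sequence.\<close>

lemma higman_finite:
  fixes w :: "nat \<Rightarrow> 'b list"
  assumes fin: "finite B" and w: "\<And>i. set (w i) \<subseteq> B"
  shows "\<exists>i j. i < j \<and> subseq (w i) (w j)"
proof (rule ccontr)
  define bad where "bad f \<longleftrightarrow> (\<forall>i. set (f i) \<subseteq> B) \<and> (\<forall>i j. i < j \<longrightarrow> \<not> subseq (f i) (f j))"
    for f :: "nat \<Rightarrow> 'b list"
  assume "\<not> ?thesis"
  then have bad_w: "bad w" using w by (auto simp: bad_def)
  have minimal: "\<exists>f. bad f \<and> (\<forall>i<n. f i = h i) \<and>
      (\<forall>g. bad g \<and> (\<forall>i<n. g i = f i) \<longrightarrow> length (f n) \<le> length (g n))" if "bad h" for h n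
  proof -
    have "bad h \<and> (\<forall>i<n. h i = h i)" using that by simp
    from ex_has_least_nat[of "\<lambda>f. bad f \<and> (\<forall>i<n. f i = h i)", OF this, of "\<lambda>f. length (f n)"]
    show ?thesis by force
  qed
  \<comment> \<open>\<open>F n\<close> has the shortest possible word at \<open>n\<close> among bad
    sequences with the same first \<open>n\<close> words. Later rows keep the words up to
    \<open>n\<close>, so the diagonal is a minimal bad sequence.\<close>
  have "\<exists>F. \<forall>n. (bad (F n) \<and> (\<forall>g. bad g \<and> (\<forall>i<n. g i = F n i) \<longrightarrow> length (F n n) \<le> length (g n)))
      \<and> (\<forall>i\<le>n. F (Suc n) i = F n i)"
  proof (rule dependent_nat_choice)
    show "\<exists>x. bad x \<and> (\<forall>g. bad g \<and> (\<forall>i<0. g i = x i) \<longrightarrow> length (x 0) \<le> length (g 0))"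
      using minimal[OF bad_w, of 0] by auto
  next
    fix x n
    assume "bad x \<and> (\<forall>g. bad g \<and> (\<forall>i<n. g i = x i) \<longrightarrow> length (x n) \<le> length (g n))"
    then show "\<exists>y. (bad y \<and> (\<forall>g. bad g \<and> (\<forall>i<Suc n. g i = y i) \<longrightarrow> length (y (Suc n)) \<le> length (g (Suc n))))
        \<and> (\<forall>i\<le>n. y i = x i)"
      using minimal[of x "Suc n"] by (metis le_imp_less_Suc)
  qed
  then obtain F where F: "\<And>n. bad (F n)"
    and F_min: "\<And>n g. bad g \<Longrightarrow> (\<And>i. i < n \<Longrightarrow> g i = F n i) \<Longrightarrow> length (F n n) \<le> length (g n)"
    and F_Suc: "\<And>n i. i \<le> n \<Longrightarrow> F (Suc n) i = F n i"
    by blast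
  define m where "m i = F i i" for i
  have F_m: "F j i = m i" if "i \<le> j" for i j
    using that by (induction rule: dec_induct) (auto simp: m_def F_Suc)
  have set_m: "set (m i) \<subseteq> B" for i
    using F[of i] by (auto simp: bad_def m_def)
  have bad_m: "\<not> subseq (m i) (m j)" if "i < j" for i j
    using F[of j] F_m[of i j] F_m[of j j] that unfolding bad_def by (metis less_imp_le order_refl)
  have m_ne: "m i \<noteq> []" for i
    using bad_m[of i "Suc i"] by auto
  have hd_B: "range (\<lambda>i. hd (m i)) \<subseteq> B"
    using set_m m_ne by (meson hd_in_set image_subsetI subsetD)
  then have "finite (range (\<lambda>i. hd (m i)))" using fin finite_subset by blast
  from pigeonhole_infinite[OF infinite_UNIV_nat this]
  obtain i0 where "infinite {i. hd (m i) = hd (m i0)}" by auto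
  then obtain e :: "nat \<Rightarrow> nat" where e: "strict_mono e" "\<And>i. hd (m (e i)) = hd (m i0)"
    using infinite_enumerate[of "{i. hd (m i) = hd (m i0)}"] by blast
  have m_e: "m (e i) = hd (m i0) # tl (m (e i))" for i
    using m_ne e(2) by (metis list.collapse)
  \<comment> \<open>An embedding into a tail would give one into the full word, and an embedding
    between two tails extends by the common letter; so \<open>g\<close> is bad, but shorter at
    \<open>e 0\<close>.\<close>
  define g where "g i = (if i < e 0 then m i else tl (m (e (i - e 0))))" for i
  have "bad g"
    unfolding bad_def
  proof (intro conjI allI impI)
    fix i
    show "set (g i) \<subseteq> B"
      by (auto simp: g_def dest: list.set_sel(2)[OF m_ne] set_m[THEN subsetD])
  next
    fix i j :: nat
    assume ij: "i < j"
    consider "j < e 0" | "i < e 0" "e 0 \<le> j" | "e 0 \<le> i" by linarith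
    then show "\<not> subseq (g i) (g j)"
    proof cases
      case 1
      then show ?thesis using ij bad_m by (simp add: g_def)
    next
      case 2
      have "e 0 \<le> e (j - e 0)" using e(1) by (simp add: strict_mono_less_eq)
      then have "\<not> subseq (m i) (m (e (j - e 0)))" using 2 bad_m by simp
      then have "\<not> subseq (m i) (tl (m (e (j - e 0))))"
        using m_e by (metis list_emb_Cons)
      then show ?thesis using 2 by (simp add: g_def)
    next
      case 3
      have "e (i - e 0) < e (j - e 0)" using e(1) 3 ij by (simp add: strict_mono_less)
      then have "\<not> subseq (m (e (i - e 0))) (m (e (j - e 0)))" using bad_m by simp
      then have "\<not> subseq (tl (m (e (i - e 0)))) (tl (m (e (j - e 0))))"
        using m_e by (metis subseq_Cons2_iff)
      then show ?thesis using 3 ij by (simp add: g_def)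
    qed
  qed
  moreover have "g i = F (e 0) i" if "i < e 0" for i
    using that F_m by (simp add: g_def)
  ultimately have "length (F (e 0) (e 0)) \<le> length (g (e 0))" by (rule F_min)
  then show False using m_ne[of "e 0"] by (cases "F (e 0) (e 0)") (auto simp: g_def m_def)
qed

lemma subseq_imp_index_map:
  assumes "subseq xs ys"
  shows "\<exists>h. (\<forall>i<length xs. h i < length ys \<and> ys ! h i = xs ! i) \<and>
             (\<forall>i j. i < j \<longrightarrow> j < length xs \<longrightarrow> h i < h j)"
  using assms
proof (induction rule: list_emb.induct)
  case (list_emb_Nil ys)
  then show ?case by simp
next
  case (list_emb_Cons xs ys y)
  then obtain h where "\<forall>i<length xs. h i < length ys \<and> ys ! h i = xs ! i"
    "\<forall>i j. i < j \<longrightarrow> j < length xs \<longrightarrow> h i < h j" by blast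
  then show ?case by (intro exI[of _ "\<lambda>i. Suc (h i)"]) auto
next
  case (list_emb_Cons2 x y xs ys)
  then obtain h where "\<forall>i<length xs. h i < length ys \<and> ys ! h i = xs ! i"
    "\<forall>i j. i < j \<longrightarrow> j < length xs \<longrightarrow> h i < h j" by blast
  then show ?case using list_emb_Cons2
    by (intro exI[of _ "\<lambda>i. case i of 0 \<Rightarrow> 0 | Suc i \<Rightarrow> Suc (h i)"])
      (auto simp: nth_Cons split: nat.splits)
qed

section \<open>A well-quasi-order on words\<close>

text \<open>The second conjunct makes substitution of variables along \<open>\<tau>\<close> strictly monotone below \<open>a\<close> for
the lexicographic order: the first position of \<open>b\<close> that reads a variable with index at least \<open>i\<close>
reads the variable \<open>i\<close> itself.\<close>

definition word_emb :: "'a list \<Rightarrow> 'a list \<Rightarrow> bool" where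
  "word_emb a b \<longleftrightarrow> (\<exists>\<tau>. (\<forall>j<length b. \<tau> j < length a \<and> a ! \<tau> j = b ! j) \<and>
      (\<forall>i<length a. \<exists>h<length b. \<tau> h = i \<and> (\<forall>j<h. \<tau> j < i)))"

text \<open>A position of \<open>b\<close> in the image of \<open>h\<close> reads its preimage, any
  other the first occurrence \<open>l\<close> of its letter in \<open>a\<close>. By
  \<open>first\<close>, \<open>h l\<close> is a first occurrence in \<open>b\<close>; thus always
  \<open>h (\<tau> j) \<le> j\<close>, and \<open>j < h i\<close> forces
  \<open>\<tau> j < i\<close>.\<close>

lemma word_embI:
  assumes ab: "set b \<subseteq> set a"
    and h: "\<And>i. i < length a \<Longrightarrow> h i < length b \<and> b ! h i = a ! i"
    and mono: "\<And>i j. i < j \<Longrightarrow> j < length a \<Longrightarrow> h i < h j"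
    and first: "\<And>i. i < length a \<Longrightarrow> a ! i \<notin> set (take i a) \<Longrightarrow> b ! h i \<notin> set (take (h i) b)"
  shows "word_emb a b"
proof -
  have "\<exists>l. l < length a \<and> a ! l = b ! j \<and> h l \<le> j \<and> (\<forall>i<length a. h i = j \<longrightarrow> l = i)"
    if j: "j < length b" for j
  proof (cases "\<exists>i<length a. h i = j")
    case True
    then obtain i where i: "i < length a" "h i = j" by blast
    moreover have "i' = i" if "i' < length a" "h i' = j" for i'
      using that i mono by (metis nat_neq_iff)
    ultimately show ?thesis using h[OF i(1)] by (metis order_refl)
  next
    case False
    have "b ! j \<in> set a" using ab j by auto
    then have ex: "\<exists>l. l < length a \<and> a ! l = b ! j" by (simp add: in_set_conv_nth)
    define l where "l = (LEAST l. l < length a \<and> a ! l = b ! j)"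
    have l: "l < length a" "a ! l = b ! j" using LeastI_ex[OF ex] by (auto simp: l_def)
    have "a ! l \<notin> set (take l a)"
    proof
      assume "a ! l \<in> set (take l a)"
      then obtain l' where "l' < l" "a ! l' = b ! j" using l by (fastforce simp: in_set_conv_nth)
      then show False
        using not_less_Least[of l' "\<lambda>l. l < length a \<and> a ! l = b ! j"] l(1) by (simp flip: l_def)
    qed
    then have "b ! j \<notin> set (take (h l) b)" using first l h by metis
    then have "h l \<le> j" using j h[OF l(1)]
      by (metis in_set_conv_nth length_take min.absorb4 not_le_imp_less nth_take)
    then show ?thesis using l False by blast
  qed
  then obtain \<tau> where \<tau>: "\<And>j. j < length b \<Longrightarrow> \<tau> j < length a \<and> a ! \<tau> j = b ! j \<and> h (\<tau> j) \<le> j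
      \<and> (\<forall>i<length a. h i = j \<longrightarrow> \<tau> j = i)"
    by metis
  have "\<tau> j < i" if "i < length a" "j < h i" for i j
  proof (rule ccontr)
    assume "\<not> \<tau> j < i"
    moreover have "j < length b" using that h by fastforce
    ultimately have "h i \<le> h (\<tau> j)" using mono \<tau> by (metis le_eq_less_or_eq not_le_imp_less)
    then show False using \<tau> \<open>j < length b\<close> that by fastforce
  qed
  then show ?thesis
    unfolding word_emb_def using \<tau> h by (intro exI[of _ \<tau>]) blast
qed

text \<open>Besides an embedding, \<open>word_embI\<close> asks for control of letter sets and of
  first occurrences, so Higman's lemma is applied to letters annotated with both and with the colour
  \<open>c i\<close>.\<close>

lemma word_emb_wqo:
  fixes w :: "nat \<Rightarrow> 'a list" and c :: "nat \<Rightarrow> 'c"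
  assumes fin: "finite A" "finite K" and w: "\<And>i. set (w i) \<subseteq> A" "\<And>i. w i \<noteq> []"
    and c: "\<And>i. c i \<in> K"
  shows "\<exists>i j. i < j \<and> c i = c j \<and> word_emb (w i) (w j)"
proof -
  define ann where "ann i = map (\<lambda>p. (w i ! p, w i ! p \<in> set (take p (w i)), set (w i), c i))
      [0..<length (w i)]" for i
  have "set (ann i) \<subseteq> A \<times> UNIV \<times> Pow A \<times> K" for i
    using w c nth_mem by (fastforce simp: ann_def)
  moreover have "finite (A \<times> (UNIV :: bool set) \<times> Pow A \<times> K)" using fin by simp
  ultimately obtain i j where ij: "i < j" "subseq (ann i) (ann j)"
    using higman_finite[of _ ann] by metis
  then obtain h where h: "\<And>p. p < length (w i) \<Longrightarrow> h p < length (w j) \<and> ann j ! h p = ann i ! p"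
    and mono: "\<And>p q. p < q \<Longrightarrow> q < length (w i) \<Longrightarrow> h p < h q"
    using subseq_imp_index_map[OF ij(2)] by (auto simp: ann_def)
  have h': "h p < length (w j) \<and> w j ! h p = w i ! p \<and> set (w j) = set (w i) \<and> c j = c i \<and>
      (w j ! h p \<in> set (take (h p) (w j)) \<longleftrightarrow> w i ! p \<in> set (take p (w i)))"
    if "p < length (w i)" for p
    using h[OF that] that by (auto simp: ann_def)
  have "word_emb (w i) (w j)"
    using h' mono w(2)[of i] by (intro word_embI[of _ _ h]) (auto, fastforce)
  then show ?thesis using ij h'[of 0] w(2)[of i] by (metis length_greater_0_conv)
qed

section \<open>Forks and closure under an edge operation\<close>

text \<open>Indices start at 0 here, so positions 4 to \<open>k+1\<close> of the definition become
  \<open>i\<close> from 3 to \<open>k\<close>.\<close>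

lemma edge_op_map_upt:
  assumes t: "edge_op A k t" "1 < k" and xy: "x \<in> A" "y \<in> A"
  shows "(\<And>m. m \<le> k \<Longrightarrow> v m = (if m < 2 then y else x)) \<Longrightarrow> t (map v [0..<k+1]) = x"
    and "(\<And>m. m \<le> k \<Longrightarrow> v m = (if m = 0 \<or> m = 2 then y else x)) \<Longrightarrow> t (map v [0..<k+1]) = x"
    and "i \<in> {3..k} \<Longrightarrow> (\<And>m. m \<le> k \<Longrightarrow> v m = (if m = i then y else x)) \<Longrightarrow> t (map v [0..<k+1]) = x"
proof -
  assume "\<And>m. m \<le> k \<Longrightarrow> v m = (if m < 2 then y else x)"
  then have "map v [0..<k+1] = y # y # replicate (k - 1) x"
    using t(2) by (intro nth_equalityI) (auto simp: nth_Cons simp del: upt_Suc split: nat.splits)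
  then show "t (map v [0..<k+1]) = x" using t(1) xy by (simp add: edge_op_def)
next
  assume "\<And>m. m \<le> k \<Longrightarrow> v m = (if m = 0 \<or> m = 2 then y else x)"
  then have "map v [0..<k+1] = y # x # y # replicate (k - 2) x"
    using t(2) by (intro nth_equalityI) (auto simp: nth_Cons simp del: upt_Suc split: nat.splits)
  then show "t (map v [0..<k+1]) = x" using t(1) xy by (simp add: edge_op_def)
next
  assume i: "i \<in> {3..k}" and "\<And>m. m \<le> k \<Longrightarrow> v m = (if m = i then y else x)"
  then have "map v [0..<k+1] = (replicate (k + 1) x)[(i + 1) - 1 := y]"
    by (intro nth_equalityI) (auto simp: nth_list_update simp del: upt_Suc replicate_Suc)
  moreover have "i + 1 \<in> {4..k+1}" using i by auto
  ultimately show "t (map v [0..<k+1]) = x" using t(1) xy unfolding edge_op_def by metis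
qed

text \<open>Put \<open>a = g x\<close>, \<open>b = f x\<close>, \<open>e = t(b,a,b,\<dots>,b)\<close>. By induction on \<open>T\<close>, some row takes the value \<open>b\<close> at \<open>x\<close>
and agrees with \<open>f\<close> on \<open>T\<close>: the rows belonging to the sets \<open>T - {\<iota> l}\<close> first yield a row agreeing with
\<open>f\<close> on \<open>T\<close> with value \<open>e\<close>, the fork lets us change the value of any row at \<open>x\<close> from \<open>b\<close> to \<open>e\<close> without
altering it on \<open>L\<close>, and then \<open>t(e,b,e,b,\<dots>,b) = b\<close> finishes.\<close>

lemma edge_closed_extend:
  assumes t: "edge_op A k t" "1 < k"
    and RA: "\<And>r y. r \<in> R \<Longrightarrow> y \<in> X \<Longrightarrow> r y \<in> A"
    and closed: "\<And>\<rho>. (\<And>m. m \<le> k \<Longrightarrow> \<rho> m \<in> R) \<Longrightarrow>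
        \<exists>r\<in>R. \<forall>y\<in>X. r y = t (map (\<lambda>m. \<rho> m y) [0..<k+1])"
    and fA: "\<And>y. y \<in> X \<Longrightarrow> f y \<in> A"
    and small: "\<And>T. T \<subseteq> X \<Longrightarrow> finite T \<Longrightarrow> card T < k \<Longrightarrow> \<exists>r\<in>R. \<forall>y\<in>T. r y = f y"
    and x: "x \<in> X" and L: "L \<subseteq> X" "finite L"
    and g: "g \<in> R" "\<And>y. y \<in> L \<Longrightarrow> g y = f y"
    and fork: "u \<in> R" "v \<in> R" "\<And>y. y \<in> L \<Longrightarrow> u y = v y" "u x = f x" "v x = g x"
  shows "\<exists>r\<in>R. (\<forall>y\<in>L. r y = f y) \<and> r x = f x"
proof -
  note E1 = edge_op_map_upt(1)[OF t] and E2 = edge_op_map_upt(2)[OF t] and E3 = edge_op_map_upt(3)[OF t]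
  have "finite T \<Longrightarrow> T \<subseteq> L \<Longrightarrow> \<exists>r\<in>R. (\<forall>y\<in>T. r y = f y) \<and> r x = f x" for T
  proof (induction T rule: finite_psubset_induct)
    case (psubset T)
    note TX = subset_trans[OF psubset.prems L(1)]
    show ?case
    proof (cases "card T < k - 1")
      case True
      then have "card (insert x T) < k" using psubset.hyps by (auto simp: card_insert_if)
      then show ?thesis
        using small[of "insert x T"] TX x psubset.hyps by auto
    next
      case False
      \<comment> \<open>Index 1 stands for the first two edge identities, 3 to \<open>k\<close> for
        the rest. As \<open>T\<close> has at least \<open>k - 1\<close> points, each index gets its
        own \<open>\<iota> l\<close>, the only point of \<open>T\<close> where
        \<open>\<rho> l\<close> may differ from \<open>f\<close>.\<close>
      define I where "I = insert 1 {3..k}"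
      have "card I = k - 1" using t(2) by (simp add: I_def)
      then have "\<exists>\<iota>. \<iota> ` I \<subseteq> T \<and> inj_on \<iota> I"
        using False psubset.hyps by (intro card_le_inj) (auto simp: I_def)
      then obtain \<iota> where inj: "inj_on \<iota> I" and \<iota>T: "\<And>l. l \<in> I \<Longrightarrow> \<iota> l \<in> T" by blast
      have "\<exists>r\<in>R. (\<forall>y\<in>T - {\<iota> l}. r y = f y) \<and> r x = f x" if "l \<in> I" for l
        using psubset.IH[of "T - {\<iota> l}"] psubset.prems \<iota>T[OF that] by blast
      then obtain \<rho> where \<rho>R: "\<And>l. l \<in> I \<Longrightarrow> \<rho> l \<in> R"
        and \<rho>f: "\<And>l y. l \<in> I \<Longrightarrow> y \<in> T \<Longrightarrow> y \<noteq> \<iota> l \<Longrightarrow> \<rho> l y = f y"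
        and \<rho>x: "\<And>l. l \<in> I \<Longrightarrow> \<rho> l x = f x"
        by (metis Diff_iff singletonD)
      have I: "1 \<in> I" "\<And>l. 3 \<le> l \<Longrightarrow> l \<le> k \<Longrightarrow> l \<in> I" by (auto simp: I_def)
      \<comment> \<open>At \<open>\<iota> 1\<close> one of the first two identities applies, at
        \<open>\<iota> l\<close> with \<open>l \<ge> 3\<close> only argument \<open>l\<close> can
        deviate, and elsewhere on \<open>T\<close> all arguments equal \<open>f y\<close>.\<close>
      have combine: "\<exists>r\<in>R. (\<forall>y\<in>X. r y = t (map (\<lambda>m. (if m = 0 then r0 else if m = 1 then r1 else
             if m = 2 then r2 else \<rho> m) y) [0..<k+1])) \<and> (\<forall>y\<in>T. r y = f y)"
        if r: "r0 \<in> R" "r1 \<in> R" "r2 \<in> R"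
          and agree: "\<And>y. y \<in> T \<Longrightarrow> y \<noteq> \<iota> 1 \<Longrightarrow> r0 y = f y \<and> r1 y = f y \<and> r2 y = f y"
          and at: "(r0 (\<iota> 1) = r1 (\<iota> 1) \<and> r2 (\<iota> 1) = f (\<iota> 1)) \<or>
                   (r0 (\<iota> 1) = r2 (\<iota> 1) \<and> r1 (\<iota> 1) = f (\<iota> 1))"
        for r0 r1 r2
      proof -
        define \<sigma> where "\<sigma> m = (if m = 0 then r0 else if m = 1 then r1 else if m = 2 then r2 else \<rho> m)" for m
        have "\<sigma> m \<in> R" if "m \<le> k" for m
          using r \<rho>R I(2)[of m] that by (auto simp: \<sigma>_def)
        from closed[of \<sigma>, OF this] obtain r
          where r': "r \<in> R" "\<And>y. y \<in> X \<Longrightarrow> r y = t (map (\<lambda>m. \<sigma> m y) [0..<k+1])" by blast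
        have "t (map (\<lambda>m. \<sigma> m y) [0..<k+1]) = f y" if y: "y \<in> T" for y
        proof -
          have yX: "y \<in> X" using y TX by blast
          note fy = fA[OF yX]
          consider "y = \<iota> 1" | l where "l \<in> {3..k}" "y = \<iota> l" | "y \<notin> \<iota> ` I"
            unfolding I_def by blast
          then show ?thesis
          proof cases
            case 1
            have ne: "y \<noteq> \<iota> l" if "l \<in> {3..k}" for l
              using inj_onD[OF inj, of 1 l] that I 1 by auto
            have \<rho>y: "\<rho> l y = f y" if "3 \<le> l" "l \<le> k" for l
              using \<rho>f[of l y] ne[of l] that y I by auto
            from at show ?thesis
            proof
              assume "r0 (\<iota> 1) = r1 (\<iota> 1) \<and> r2 (\<iota> 1) = f (\<iota> 1)"
              then show ?thesis using 1 \<rho>y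
                by (intro E1[OF fy RA[OF r(1) yX]]) (auto simp: \<sigma>_def)
            next
              assume "r0 (\<iota> 1) = r2 (\<iota> 1) \<and> r1 (\<iota> 1) = f (\<iota> 1)"
              then show ?thesis using 1 \<rho>y
                by (intro E2[OF fy RA[OF r(1) yX]]) (auto simp: \<sigma>_def)
            qed
          next
            case (2 l)
            have ne: "y \<noteq> \<iota> l'" if "l' \<in> I" "l' \<noteq> l" for l'
              using inj_onD[OF inj, of l l'] that I(2)[of l] 2 by auto
            have "y \<noteq> \<iota> 1" using ne[OF I(1)] 2(1) by auto
            then have "r0 y = f y \<and> r1 y = f y \<and> r2 y = f y" using agree y by blast
            moreover have "\<rho> l' y = f y" if "3 \<le> l'" "l' \<le> k" "l' \<noteq> l" for l'
              using \<rho>f[of l' y] ne[of l'] that y I by auto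
            ultimately show ?thesis
              using 2(1) I(2)[of l]
              by (intro E3[OF fy RA[OF \<rho>R[of l] yX] 2(1)]) (auto simp: \<sigma>_def)
          next
            case 3
            then have "r0 y = f y \<and> r1 y = f y \<and> r2 y = f y" using agree[OF y] I(1) by blast
            moreover have "\<rho> l y = f y" if "3 \<le> l" "l \<le> k" for l
              using \<rho>f[of l y] that y I(2)[of l] 3 by blast
            ultimately show ?thesis
              by (intro E1[OF fy fy]) (auto simp: \<sigma>_def)
          qed
        qed
        then show ?thesis using r' TX unfolding \<sigma>_def by (intro bexI[of _ r]) auto
      qed
      define q where "q = \<rho> 1"
      have q: "q \<in> R" "q x = f x" "\<And>y. y \<in> T \<Longrightarrow> y \<noteq> \<iota> 1 \<Longrightarrow> q y = f y"
        using \<rho>R \<rho>x \<rho>f I(1) by (auto simp: q_def)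
      have gT: "g y = f y" if "y \<in> T" for y using g(2) that psubset.prems by blast
      define e where "e = t (map (\<lambda>m. if m = 1 then g x else f x) [0..<k+1])"
      obtain h where h: "h \<in> R" "\<And>y. y \<in> T \<Longrightarrow> h y = f y" "h x = e"
      proof -
        have "\<exists>r\<in>R. (\<forall>y\<in>X. r y = t (map (\<lambda>m. (if m = 0 then q else if m = 1 then g else
             if m = 2 then q else \<rho> m) y) [0..<k+1])) \<and> (\<forall>y\<in>T. r y = f y)"
          using q g gT \<iota>T[OF I(1)] by (intro combine) auto
        then obtain r where r: "r \<in> R" "\<forall>y\<in>T. r y = f y"
          "r x = t (map (\<lambda>m. (if m = 0 then q else if m = 1 then g else if m = 2 then q else \<rho> m) x) [0..<k+1])"
          using x by blast
        note r(3)
        also have "map (\<lambda>m. (if m = 0 then q else if m = 1 then g else if m = 2 then q else \<rho> m) x) [0..<k+1]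
            = map (\<lambda>m. if m = 1 then g x else f x) [0..<k+1]"
          using q(2) \<rho>x I(2) by (intro map_cong) auto
        finally show thesis using that r unfolding e_def by blast
      qed
      \<comment> \<open>The row is \<open>t(u,v,q,...,q)\<close>: on \<open>L\<close>, where
        \<open>u\<close> and \<open>v\<close> coincide, the first identity returns \<open>q\<close>,
        while at \<open>x\<close> the arguments are those defining \<open>e\<close>.\<close>
      obtain q' where q': "q' \<in> R" "\<And>y. y \<in> L \<Longrightarrow> q' y = q y" "q' x = e"
      proof -
        have "\<exists>r\<in>R. \<forall>y\<in>X. r y = t (map (\<lambda>m. (if m = 0 then u else if m = 1 then v else q) y) [0..<k+1])"
          using fork q by (intro closed) auto
        then obtain r where r: "r \<in> R"
          "\<And>y. y \<in> X \<Longrightarrow> r y = t (map (\<lambda>m. (if m = 0 then u else if m = 1 then v else q) y) [0..<k+1])"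
          by blast
        have "r y = q y" if "y \<in> L" for y
        proof -
          have y: "y \<in> X" using that L by blast
          show ?thesis
            unfolding r(2)[OF y] using fork(3)[OF that]
            by (intro E1[OF RA[OF q(1) y] RA[OF fork(1) y]]) auto
        qed
        moreover have "r x = e"
          unfolding r(2)[OF x] e_def using fork q
          by (intro arg_cong[of _ _ t] map_cong) auto
        ultimately show thesis using that r by blast
      qed
      have q'T: "q' y = q y" if "y \<in> T" for y using q'(2) that psubset.prems by blast
      \<comment> \<open>At \<open>\<iota> 1\<close> the first identity applies, as \<open>q'\<close>
        and \<open>q\<close> coincide on \<open>T\<close>. At \<open>x\<close> the arguments are
        \<open>e\<close>, \<open>f x\<close>, \<open>e\<close> and then only \<open>f x\<close>, so
        the second identity returns \<open>f x\<close>.\<close>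
      have "\<exists>r\<in>R. (\<forall>y\<in>X. r y = t (map (\<lambda>m. (if m = 0 then q' else if m = 1 then q else
             if m = 2 then h else \<rho> m) y) [0..<k+1])) \<and> (\<forall>y\<in>T. r y = f y)"
        using q q' q'T h \<iota>T[OF I(1)] by (intro combine) auto
      then obtain r where r: "r \<in> R" "\<forall>y\<in>T. r y = f y"
        "r x = t (map (\<lambda>m. (if m = 0 then q' else if m = 1 then q else if m = 2 then h else \<rho> m) x) [0..<k+1])"
        using x by blast
      have "r x = f x"
        unfolding r(3) using q q' h \<rho>x I(2) RA[OF h(1) x] t(2)
        by (intro E2[OF fA[OF x], of e]) auto
      then show ?thesis using r by blast
    qed
  qed
  from this[OF L(2)] show ?thesis by simp
qed

text \<open>The points are treated in increasing order of \<open>key\<close>: a row correct strictly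
  below \<open>x\<close> is replaced by one correct at \<open>x\<close> as well, using
  \<open>edge_closed_extend\<close> with \<open>L\<close> the set of points below
  \<open>x\<close>.\<close>

lemma edge_closed_represented:
  fixes key :: "'i \<Rightarrow> 'o :: linorder"
  assumes t: "edge_op A k t" "1 < k"
    and RA: "\<And>r y. r \<in> R \<Longrightarrow> y \<in> X \<Longrightarrow> r y \<in> A"
    and closed: "\<And>\<rho>. (\<And>m. m \<le> k \<Longrightarrow> \<rho> m \<in> R) \<Longrightarrow>
        \<exists>r\<in>R. \<forall>y\<in>X. r y = t (map (\<lambda>m. \<rho> m y) [0..<k+1])"
    and fA: "\<And>y. y \<in> X \<Longrightarrow> f y \<in> A"
    and small: "\<And>T. T \<subseteq> X \<Longrightarrow> finite T \<Longrightarrow> card T < k \<Longrightarrow> \<exists>r\<in>R. \<forall>y\<in>T. r y = f y"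
    and X: "finite X" and key: "inj_on key X"
    and fork: "\<And>x g. x \<in> X \<Longrightarrow> g \<in> R \<Longrightarrow> (\<And>y. y \<in> X \<Longrightarrow> key y < key x \<Longrightarrow> g y = f y) \<Longrightarrow>
       \<exists>u\<in>R. \<exists>v\<in>R. (\<forall>y\<in>X. key y < key x \<longrightarrow> u y = v y) \<and> u x = f x \<and> v x = g x"
  shows "\<exists>r\<in>R. \<forall>y\<in>X. r y = f y"
proof -
  have "Y \<subseteq> X \<Longrightarrow> (\<And>x y. x \<in> X \<Longrightarrow> y \<in> Y \<Longrightarrow> key x < key y \<Longrightarrow> x \<in> Y) \<Longrightarrow>
      \<exists>r\<in>R. \<forall>y\<in>Y. r y = f y" if "finite Y" for Y
    using that
  proof (induction Y rule: finite_ranking_induct[where f = key])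
    case empty
    then show ?case using small[of "{}"] t(2) by auto
  next
    case (insert x S)
    show ?case
    proof (cases "x \<in> S")
      case True
      then show ?thesis using insert by (simp add: insert_absorb)
    next
      case False
      have S: "S = {y \<in> X. key y < key x}"
      proof (intro equalityI subsetI)
        fix y assume y: "y \<in> S"
        then have "key y \<noteq> key x" using False insert.prems(1) key by (auto dest: inj_onD)
        then show "y \<in> {y \<in> X. key y < key x}"
          using y insert.hyps insert.prems(1) by (auto simp: order_less_le)
      next
        fix y assume "y \<in> {y \<in> X. key y < key x}"
        then show "y \<in> S" using insert.prems(2)[of y x] by auto
      qed
      then obtain g where g: "g \<in> R" "\<And>y. y \<in> S \<Longrightarrow> g y = f y"
        using insert.IH insert.prems(1) by (smt (verit) insert_subset mem_Collect_eq order_less_trans)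
      have x: "x \<in> X" using insert.prems by simp
      obtain u v where uv: "u \<in> R" "v \<in> R" "\<And>y. y \<in> S \<Longrightarrow> u y = v y" "u x = f x" "v x = g x"
        using fork[OF x g(1)] g(2) unfolding S by blast
      have "\<exists>r\<in>R. (\<forall>y\<in>S. r y = f y) \<and> r x = f x"
        by (rule edge_closed_extend[where A = A and X = X and L = S and g = g and u = u and v = v and k = k and t = t])
          (use assms x g uv insert.hyps S in auto)
      then show ?thesis by auto
    qed
  qed
  from this[OF X] show ?thesis by blast
qed

section \<open>Forks of a clone\<close>

lemma finite_tuples: "finite A \<Longrightarrow> finite (tuples A n)"
  unfolding tuples_def using finite_lists_length_eq[of A n] by (simp add: conj_commute)

lemma finite_ops: "finite A \<Longrightarrow> finite {f. is_op A n f}"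
  by (rule finite_subset[OF _ finite_set_of_finite_funs[of "tuples A n" A undefined]])
    (auto simp: is_op_def finite_tuples)

lemma clone_is_op: "clone A C \<Longrightarrow> (n, f) \<in> C \<Longrightarrow> is_op A n f"
  by (auto simp: clone_def Ops_def)

lemma is_op_eqI:
  assumes "is_op A n f" "is_op A n g" "\<And>x. x \<in> tuples A n \<Longrightarrow> f x = g x"
  shows "f = g"
  using assms unfolding is_op_def by (metis ext)

text \<open>Variable \<open>\<sigma> p\<close> is substituted for argument \<open>p\<close>; this
  covers permuting and identifying variables and adding dummy ones.\<close>

definition minor :: "'a set \<Rightarrow> nat \<Rightarrow> (nat \<Rightarrow> nat) \<Rightarrow> nat \<Rightarrow> ('a list \<Rightarrow> 'a) \<Rightarrow> 'a list \<Rightarrow> 'a" where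
  "minor A m \<sigma> n f = (\<lambda>x. if x \<in> tuples A m then f (map (\<lambda>p. x ! \<sigma> p) [0..<n]) else undefined)"

lemma clone_minor:
  assumes C: "clone A C" "(n, f) \<in> C" and m: "0 < m" and \<sigma>: "\<And>p. p < n \<Longrightarrow> \<sigma> p < m"
  shows "(m, minor A m \<sigma> n f) \<in> C"
proof -
  define gs where "gs = map (\<lambda>p. snd (proj A m (\<sigma> p))) [0..<n]"
  have "(m, snd (proj A m (\<sigma> p))) \<in> C" if "p < n" for p
    using C(1) m \<sigma>[OF that] by (auto simp: clone_def proj_def)
  then have "compose A f m gs \<in> C"
    using C unfolding clone_def by (auto simp: gs_def)
  moreover have "compose A f m gs = (m, minor A m \<sigma> n f)"
    by (auto simp: compose_def minor_def gs_def proj_def comp_def)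
  ultimately show ?thesis by simp
qed

lemma map_nth_in_tuples:
  assumes "x \<in> tuples A m" "\<And>p. p < n \<Longrightarrow> \<sigma> p < m"
  shows "map (\<lambda>p. x ! \<sigma> p) [0..<n] \<in> tuples A n"
  using assms by (auto simp: tuples_def subset_iff)

text \<open>The \<open>n\<close>-ary part of \<open>C\<close> is a subpower of \<open>A\<close> with
  coordinates in \<open>A^n\<close>; these are its forks in the sense of compact representations of
  subpowers. The numbering \<open>rk\<close> serves to order the coordinates
  lexicographically.\<close>

definition fork :: "('a \<Rightarrow> nat) \<Rightarrow> 'a set \<Rightarrow> (nat \<times> ('a list \<Rightarrow> 'a)) set \<Rightarrow> 'a list \<Rightarrow> 'a \<Rightarrow> 'a \<Rightarrow> bool" where
  "fork rk A C w a b \<longleftrightarrow> (\<exists>u v. (length w, u) \<in> C \<and> (length w, v) \<in> C \<and>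
     (\<forall>x \<in> tuples A (length w). map rk x < map rk w \<longrightarrow> u x = v x) \<and> u w = a \<and> v w = b)"

lemma less_list_nth_iff:
  fixes x y :: "'b :: linorder list"
  assumes "length x = length y"
  shows "x < y \<longleftrightarrow> (\<exists>i<length y. (\<forall>j<i. x ! j = y ! j) \<and> x ! i < y ! i)"
proof -
  have "take i x = take i y \<longleftrightarrow> (\<forall>j<i. x ! j = y ! j)" if "i < length y" for i
    using that assms by (auto simp: list_eq_iff_nth_eq)
  then show ?thesis
    using assms by (auto simp: list_less_def lexord_take_index_conv)
qed

text \<open>Both witnesses are substituted along \<open>\<tau>\<close>. If \<open>x\<close> lies
  below \<open>w\<close> and first differs from it at \<open>i\<close>, some position
  \<open>h\<close> reads \<open>i\<close> while all earlier ones read indices below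
  \<open>i\<close>; so the substituted tuple first differs from \<open>w'\<close> at
  \<open>h\<close> and is smaller there.\<close>

lemma fork_antimono:
  assumes C: "clone A C" and rk: "inj_on rk A" and w: "set w \<subseteq> A" "w \<noteq> []"
    and emb: "word_emb w w'" and f: "fork rk A C w' a b"
  shows "fork rk A C w a b"
proof -
  let ?m = "length w" and ?n = "length w'"
  obtain \<tau> where \<tau>: "\<And>j. j < ?n \<Longrightarrow> \<tau> j < ?m" "\<And>j. j < ?n \<Longrightarrow> w ! \<tau> j = w' ! j"
    and first: "\<And>i. i < ?m \<Longrightarrow> \<exists>h<?n. \<tau> h = i \<and> (\<forall>j<h. \<tau> j < i)"
    using emb unfolding word_emb_def by blast
  obtain u v where uv: "(?n, u) \<in> C" "(?n, v) \<in> C" "u w' = a" "v w' = b"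
    and agree: "\<And>x. x \<in> tuples A ?n \<Longrightarrow> map rk x < map rk w' \<Longrightarrow> u x = v x"
    using f unfolding fork_def by blast
  have w': "map (\<lambda>p. w ! \<tau> p) [0..<?n] = w'"
    using \<tau> by (auto intro: nth_equalityI)
  have wt: "w \<in> tuples A ?m" using w by (simp add: tuples_def)
  have "minor A ?m \<tau> ?n u x = minor A ?m \<tau> ?n v x"
    if x: "x \<in> tuples A ?m" "map rk x < map rk w" for x
  proof -
    have len: "length x = ?m" and xA: "set x \<subseteq> A" using x by (auto simp: tuples_def)
    then obtain i where i: "i < ?m" "\<And>j. j < i \<Longrightarrow> rk (x ! j) = rk (w ! j)" "rk (x ! i) < rk (w ! i)"
      using x(2) less_list_nth_iff[of "map rk x" "map rk w"] by auto
    obtain h where h: "h < ?n" "\<tau> h = i" "\<And>j. j < h \<Longrightarrow> \<tau> j < i" using first[OF i(1)] by blast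
    let ?x = "map (\<lambda>p. x ! \<tau> p) [0..<?n]"
    have "map rk ?x < map rk w'"
      using len i h \<tau>(2) by (subst less_list_nth_iff) (auto intro!: exI[of _ h] simp flip: \<tau>(2))
    then have "u ?x = v ?x" using agree map_nth_in_tuples[of x A ?m ?n \<tau>] x(1) \<tau>(1) by blast
    then show ?thesis using x by (simp add: minor_def)
  qed
  moreover have "(?m, minor A ?m \<tau> ?n u) \<in> C" "(?m, minor A ?m \<tau> ?n v) \<in> C"
    using w(2) uv(1,2) \<tau>(1) by (auto intro: clone_minor[OF C])
  moreover have "minor A ?m \<tau> ?n u w = a" "minor A ?m \<tau> ?n v w = b"
    using uv(3,4) wt by (simp_all add: minor_def w')
  ultimately show ?thesis unfolding fork_def by blast
qed

text \<open>With the points of \<open>T\<close> as rows of a matrix, the \<open>n\<close> columns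
  are words of length at most \<open>k\<close>, so at most \<open>N\<close> are distinct.
  Identifying variables with equal columns leaves the values of \<open>f\<close> on \<open>T\<close>
  unchanged and passes through an \<open>N\<close>-ary operation, which \<open>eq\<close> puts into
  \<open>C\<close>.\<close>

lemma clone_interpolate_few_points:
  assumes CD: "clone A C" "clone A D"
    and N: "N = card {xs. set xs \<subseteq> A \<and> length xs \<le> k}" and A: "finite A"
    and eq: "\<And>f. (N, f) \<in> D \<Longrightarrow> (N, f) \<in> C"
    and f: "(n, f) \<in> D" and T: "T \<subseteq> tuples A n" "finite T" "card T \<le> k"
  shows "\<exists>g. (n, g) \<in> C \<and> (\<forall>x\<in>T. g x = f x)"
proof -
  let ?S = "{xs. set xs \<subseteq> A \<and> length xs \<le> k}"
  have fin: "finite ?S" by (rule finite_lists_length_le[OF A])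
  have n: "0 < n" using clone_is_op[OF CD(2) f] by (simp add: is_op_def)
  have "[] \<in> ?S" by simp
  then have N0: "0 < N" unfolding N using fin card_gt_0_iff by blast
  obtain e where e: "bij_betw e ?S {..<N}"
    using ex_bij_betw_finite_nat[OF fin] unfolding N by (auto simp: atLeast0LessThan)
  obtain ts where ts: "set ts = T" "distinct ts" using finite_distinct_list[OF T(2)] by blast
  then have len_ts: "length ts \<le> k" using T(3) by (metis distinct_card)
  define col where "col p = map (\<lambda>x. x ! p) ts" for p
  define \<sigma> where "\<sigma> p = e (col p)" for p
  have col: "col p \<in> ?S" if "p < n" for p
    using T(1) len_ts that ts(1) unfolding col_def tuples_def by (auto simp: subset_iff)
  then have \<sigma>: "\<sigma> p < N" if "p < n" for p
    using that e unfolding \<sigma>_def bij_betw_def by blast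
  \<comment> \<open>One place is picked for each column number in use; the default 0 for the other
    numbers is a legal place because \<open>n\<close> is positive.\<close>
  define \<rho> where "\<rho> q = (if \<exists>p<n. \<sigma> p = q then SOME p. p < n \<and> \<sigma> p = q else 0)" for q
  have \<rho>n: "\<rho> q < n" for q
    using n someI_ex[of "\<lambda>p. p < n \<and> \<sigma> p = q"] by (auto simp: \<rho>_def)
  have \<sigma>\<rho>: "\<sigma> (\<rho> (\<sigma> p)) = \<sigma> p" if "p < n" for p
    using that someI_ex[of "\<lambda>p'. p' < n \<and> \<sigma> p' = \<sigma> p"] unfolding \<rho>_def by auto
  have "col (\<rho> (\<sigma> p)) = col p" if "p < n" for p
    using \<sigma>\<rho>[OF that] col[OF that] col[OF \<rho>n] e unfolding bij_betw_def inj_on_def \<sigma>_def by blast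
  then have same: "x ! \<rho> (\<sigma> p) = x ! p" if "p < n" "x \<in> T" for p x
    using that ts(1) unfolding col_def by (metis map_eq_conv)
  define f' where "f' = minor A N \<sigma> n f"
  define g where "g = minor A n \<rho> N f'"
  have "(N, f') \<in> D" unfolding f'_def by (rule clone_minor[OF CD(2) f N0 \<sigma>])
  then have gC: "(n, g) \<in> C" unfolding g_def using eq clone_minor[OF CD(1) _ n] \<rho>n by blast
  have "g x = f x" if x: "x \<in> T" for x
  proof -
    have xn: "x \<in> tuples A n" using x T(1) by blast
    have "g x = f (map (\<lambda>p. map (\<lambda>q. x ! \<rho> q) [0..<N] ! \<sigma> p) [0..<n])"
      using xn map_nth_in_tuples[OF xn, of N \<rho>] \<rho>n by (simp add: g_def f'_def minor_def)
    also have "map (\<lambda>p. map (\<lambda>q. x ! \<rho> q) [0..<N] ! \<sigma> p) [0..<n] = x"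
      using xn same[OF _ x] \<sigma> by (auto intro!: nth_equalityI simp: tuples_def)
    finally show ?thesis .
  qed
  then show ?thesis using gC by blast
qed

text \<open>For \<open>n\<close>-ary \<open>f\<close> in \<open>D\<close>, the \<open>n\<close>-ary
  operations of \<open>C\<close> are the rows and the tuples are the points. A row \<open>g\<close>
  agreeing with \<open>f\<close> below \<open>x\<close> gives a fork of \<open>D\<close> at
  \<open>x\<close>, witnessed by \<open>f\<close> and \<open>g\<close>, which \<open>C\<close> then
  has too. Fewer than \<open>k\<close> points means at most \<open>k - 1\<close>, whence the bound
  in \<open>N\<close>.\<close>

lemma clone_eq_if_same_forks:
  assumes CD: "clone A C" "clone A D" "C \<subseteq> D" and A: "finite A" and k: "1 < k"
    and t: "(k + 1, t) \<in> C" "edge_op A k t"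
    and N: "N = card {xs. set xs \<subseteq> A \<and> length xs \<le> k - 1}"
    and eq: "\<And>f. (N, f) \<in> D \<Longrightarrow> (N, f) \<in> C"
    and rk: "inj_on rk A"
    and forks: "\<And>w a b. set w \<subseteq> A \<Longrightarrow> w \<noteq> [] \<Longrightarrow> a \<in> A \<Longrightarrow> b \<in> A \<Longrightarrow> fork rk A D w a b \<Longrightarrow> fork rk A C w a b"
  shows "C = D"
proof
  show "D \<subseteq> C"
  proof
    fix p assume "p \<in> D"
    then obtain n f where p: "p = (n, f)" and f: "(n, f) \<in> D" by (cases p) auto
    have fop: "is_op A n f" using clone_is_op[OF CD(2) f] .
    let ?R = "{g. (n, g) \<in> C}" and ?X = "tuples A n"
    have Rop: "is_op A n g" if "g \<in> ?R" for g using clone_is_op[OF CD(1)] that by simp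
    have n: "0 < n" using fop by (simp add: is_op_def)
    have "\<exists>r\<in>?R. \<forall>y\<in>?X. r y = f y"
    proof (rule edge_closed_represented[OF t(2) k, where key = "map rk"])
      fix r y assume "r \<in> ?R" "y \<in> ?X"
      then show "r y \<in> A" using Rop[of r] by (simp add: is_op_def)
    next
      fix \<rho> assume \<rho>: "\<And>m. m \<le> k \<Longrightarrow> \<rho> m \<in> ?R"
      have "compose A t n (map \<rho> [0..<k+1]) \<in> C"
        using CD(1) t(1) \<rho> unfolding clone_def by (auto simp del: upt_Suc)
      then show "\<exists>r\<in>?R. \<forall>y\<in>?X. r y = t (map (\<lambda>m. \<rho> m y) [0..<k+1])"
        unfolding compose_def by (auto simp: comp_def simp del: upt_Suc intro!: bexI)
    next
      fix y assume "y \<in> ?X"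
      then show "f y \<in> A" using fop by (simp add: is_op_def)
    next
      fix T assume "T \<subseteq> ?X" "finite T" "card T < k"
      then show "\<exists>r\<in>?R. \<forall>y\<in>T. r y = f y"
        using clone_interpolate_few_points[OF CD(1,2) N A eq f] by auto
    next
      show "finite ?X" by (rule finite_tuples[OF A])
    next
      show "inj_on (map rk) ?X"
      proof (rule inj_onI)
        fix x y assume "x \<in> ?X" "y \<in> ?X" and eq: "map rk x = map rk y"
        then have "set x \<union> set y \<subseteq> A" by (auto simp: tuples_def)
        then show "x = y" using map_inj_on[OF eq] inj_on_subset[OF rk] by blast
      qed
    next
      fix x g assume x: "x \<in> ?X" and g: "g \<in> ?R"
        and agree: "\<And>y. y \<in> ?X \<Longrightarrow> map rk y < map rk x \<Longrightarrow> g y = f y"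
      have len: "length x = n" "set x \<subseteq> A" using x by (auto simp: tuples_def)
      have "fork rk A D x (f x) (g x)"
        unfolding fork_def len using f g CD(3) agree by (intro exI[of _ f] exI[of _ g]) auto
      then have "fork rk A C x (f x) (g x)"
        using forks[of x "f x" "g x"] len n fop Rop[OF g] x by (auto simp: is_op_def)
      then show "\<exists>u\<in>?R. \<exists>v\<in>?R. (\<forall>y\<in>?X. map rk y < map rk x \<longrightarrow> u y = v y) \<and> u x = f x \<and> v x = g x"
        unfolding fork_def len by blast
    qed
    then obtain r where "(n, r) \<in> C" "\<forall>y\<in>?X. r y = f y" by blast
    then show "p \<in> C" using is_op_eqI[OF _ fop, of r] Rop[of r] p by auto
  qed
qed (use CD in blast)

section \<open>The descending chain condition\<close>

text \<open>Once the \<open>N\<close>-ary parts are constant, every step of the chain loses a fork,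
  by \<open>clone_eq_if_same_forks\<close>. Two lost forks with equal values and comparable words
  are contradictory.\<close>

lemma clones_with_edge_dcc:
  assumes A: "finite A" and k: "1 < k"
    and c: "\<And>i :: nat. c i \<in> clones_with_edge A k" "\<And>i. c (Suc i) \<subset> c i"
  shows False
proof -
  define N where "N = card {xs. set xs \<subseteq> A \<and> length xs \<le> k - 1}"
  obtain rk :: "'a \<Rightarrow> nat" where rk: "inj_on rk A"
    using finite_imp_inj_to_nat_seg[OF A] by blast
  have clone_c: "clone A (c i)" for i using c(1) by (auto simp: clones_with_edge_def)
  have anti: "c j \<subseteq> c i" if "i \<le> j" for i j
    using lift_Suc_antimono_le[of c, OF _ that] c(2) by blast
  define F where "F i = {f. (N, f) \<in> c i}" for i
  have finF: "finite (F i)" for i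
    by (rule finite_subset[OF _ finite_ops[OF A, of N]]) (auto simp: F_def dest: clone_is_op[OF clone_c])
  \<comment> \<open>The sets \<open>F i\<close> are finite and decreasing, so they are constant from
    the least cardinality on.\<close>
  obtain i0 where i0: "\<And>j. card (F i0) \<le> card (F j)"
    using ex_has_least_nat[of "\<lambda>_. True" _ "\<lambda>i. card (F i)"] by blast
  have F_eq: "F j = F i0" if "i0 \<le> j" for j
    using card_seteq[OF finF[of i0], of "F j"] anti[OF that] i0 by (auto simp: F_def)
  have "\<exists>w a b. set w \<subseteq> A \<and> w \<noteq> [] \<and> a \<in> A \<and> b \<in> A \<and>
      fork rk A (c (i0 + i)) w a b \<and> \<not> fork rk A (c (Suc (i0 + i))) w a b" for i
  proof (rule ccontr)
    assume neg: "\<not> ?thesis"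
    obtain t where t: "(k + 1, t) \<in> c (Suc (i0 + i))" "edge_op A k t"
      using c(1) unfolding clones_with_edge_def by blast
    have "c (Suc (i0 + i)) = c (i0 + i)"
    proof (rule clone_eq_if_same_forks[OF clone_c clone_c _ A k t N_def _ rk])
      show "c (Suc (i0 + i)) \<subseteq> c (i0 + i)" using c(2) by blast
    next
      fix f assume "(N, f) \<in> c (i0 + i)"
      then show "(N, f) \<in> c (Suc (i0 + i))"
        using F_eq[of "i0 + i"] F_eq[of "Suc (i0 + i)"] by (auto simp: F_def)
    qed (use neg in blast)
    then show False using c(2) by blast
  qed
  then obtain w a b where w: "\<And>i. set (w i) \<subseteq> A" "\<And>i. w i \<noteq> []"
    and ab: "\<And>i. a i \<in> A" "\<And>i. b i \<in> A"
    and fork: "\<And>i. fork rk A (c (i0 + i)) (w i) (a i) (b i)"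
    and not_fork: "\<And>i. \<not> fork rk A (c (Suc (i0 + i))) (w i) (a i) (b i)"
    by metis
  obtain i j where ij: "i < j" "a i = a j" "b i = b j" "word_emb (w i) (w j)"
    using word_emb_wqo[of A "A \<times> A" w "\<lambda>i. (a i, b i)"] A w ab by auto
  \<comment> \<open>The clone \<open>c (i0 + j)\<close> has the fork at \<open>w j\<close>, hence at
    \<open>w i\<close>; it is contained in \<open>c (Suc (i0 + i))\<close>, which was chosen to lack
    that fork.\<close>
  have "fork rk A (c (i0 + j)) (w i) (a i) (b i)"
    using fork_antimono[OF clone_c rk w ij(4)] fork[of j] ij by simp
  then have "fork rk A (c (Suc (i0 + i))) (w i) (a i) (b i)"
    using anti[of "Suc (i0 + i)" "i0 + j"] ij(1) unfolding fork_def by (auto 0 4)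
  then show False using not_fork by blast
qed

section \<open>Clones as polymorphism clones of a single relation\<close>

text \<open>These are the polymorphisms of the \<open>n\<close>-ary part of \<open>C\<close>, read
  as a relation with coordinates in \<open>A^n\<close>; composition expresses this without an
  enumeration of \<open>A^n\<close>.\<close>

definition stabilizer :: "'a set \<Rightarrow> (nat \<times> ('a list \<Rightarrow> 'a)) set \<Rightarrow> nat \<Rightarrow> (nat \<times> ('a list \<Rightarrow> 'a)) set" where
  "stabilizer A C n = {(q, f) \<in> Ops A. \<forall>gs. length gs = q \<and> (\<forall>g\<in>set gs. (n, g) \<in> C) \<longrightarrow> compose A f n gs \<in> C}"

lemma map_apply_in_tuples:
  assumes "\<And>g. g \<in> set gs \<Longrightarrow> is_op A n g" "x \<in> tuples A n"
  shows "map (\<lambda>g. g x) gs \<in> tuples A (length gs)"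
  using assms by (auto simp: tuples_def is_op_def)

lemma compose_is_op:
  assumes "is_op A q f" "length gs = q" "\<And>g. g \<in> set gs \<Longrightarrow> is_op A n g"
  shows "is_op A n (snd (compose A f n gs))"
proof -
  have "gs \<noteq> []" using assms(1,2) by (auto simp: is_op_def)
  then have "0 < n" using assms(3)[of "hd gs"] by (auto simp: is_op_def)
  moreover have "f (map (\<lambda>g. g x) gs) \<in> A" if "x \<in> tuples A n" for x
    using map_apply_in_tuples[OF assms(3) that] assms(1,2) by (auto simp: is_op_def)
  ultimately show ?thesis by (auto simp: is_op_def compose_def)
qed

text \<open>The list \<open>ws\<close> turns each \<open>n\<close>-ary operation into its table of
  values. Applying \<open>f\<close> to tables coordinatewise gives the table of the composition, and
  a table determines its operation because values outside \<open>A^n\<close> are fixed.\<close>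

lemma stabilizer_eq_Pol:
  assumes C: "clone A C" and ws: "set ws = tuples A n"
  shows "stabilizer A C n = Pol A {(length ws, (\<lambda>g. map g ws) ` {g. (n, g) \<in> C})}"
proof -
  let ?R = "(\<lambda>g. map g ws) ` {g. (n, g) \<in> C}"
  have "preserves q f (length ws) ?R \<longleftrightarrow>
      (\<forall>gs. length gs = q \<and> (\<forall>g\<in>set gs. (n, g) \<in> C) \<longrightarrow> compose A f n gs \<in> C)"
    if f: "is_op A q f" for q f
  proof -
    have key: "map (\<lambda>j. f (map (\<lambda>r. r ! j) (map (\<lambda>g. map g ws) gs))) [0..<length ws] \<in> ?R
        \<longleftrightarrow> compose A f n gs \<in> C"
      if gs: "length gs = q" "\<forall>g\<in>set gs. (n, g) \<in> C" for gs
    proof -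
      let ?h = "snd (compose A f n gs)"
      have op: "is_op A n ?h"
        using compose_is_op[OF f gs(1)] clone_is_op[OF C] gs(2) by blast
      have "map (\<lambda>j. f (map (\<lambda>r. r ! j) (map (\<lambda>g. map g ws) gs))) [0..<length ws] = map ?h ws"
        using ws nth_mem by (intro nth_equalityI) (fastforce simp: compose_def comp_def cong: map_cong)+
      moreover have "map ?h ws \<in> ?R \<longleftrightarrow> (n, ?h) \<in> C"
      proof
        assume "map ?h ws \<in> ?R"
        then obtain g where g: "(n, g) \<in> C" "map ?h ws = map g ws" by auto
        then have "?h = g"
          using ws by (intro is_op_eqI[OF op clone_is_op[OF C]]) auto
        then show "(n, ?h) \<in> C" using g by simp
      qed auto
      ultimately show ?thesis by (simp add: compose_def)
    qed
    have rows: "(length rs = q \<and> set rs \<subseteq> ?R) \<longleftrightarrow>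
        (\<exists>gs. rs = map (\<lambda>g. map g ws) gs \<and> length gs = q \<and> (\<forall>g\<in>set gs. (n, g) \<in> C))" for rs
    proof
      assume rs: "length rs = q \<and> set rs \<subseteq> ?R"
      then have "rs \<in> lists ?R" by auto
      then obtain gs where "gs \<in> lists {g. (n, g) \<in> C}" "rs = map (\<lambda>g. map g ws) gs"
        unfolding lists_image by blast
      then show "\<exists>gs. rs = map (\<lambda>g. map g ws) gs \<and> length gs = q \<and> (\<forall>g\<in>set gs. (n, g) \<in> C)"
        using rs by (intro exI[of _ gs]) auto
    next
      assume "\<exists>gs. rs = map (\<lambda>g. map g ws) gs \<and> length gs = q \<and> (\<forall>g\<in>set gs. (n, g) \<in> C)"
      then show "length rs = q \<and> set rs \<subseteq> ?R" by (elim exE conjE) (simp, blast)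
    qed
    show ?thesis unfolding preserves_def rows using key by blast
  qed
  then show ?thesis by (auto simp: stabilizer_def Pol_def Ops_def)
qed

lemma clone_subset_stabilizer: "clone A C \<Longrightarrow> C \<subseteq> stabilizer A C n"
  by (auto simp: clone_def stabilizer_def)

text \<open>Composing \<open>f\<close> with the \<open>n\<close> projections gives back
  \<open>f\<close>.\<close>

lemma stabilizer_same_arity:
  assumes C: "clone A C" and f: "(n, f) \<in> stabilizer A C n"
  shows "(n, f) \<in> C"
proof -
  have op: "is_op A n f" using f by (simp add: stabilizer_def Ops_def)
  define gs where "gs = map (\<lambda>i. snd (proj A n i)) [0..<n]"
  have "\<forall>g\<in>set gs. (n, g) \<in> C"
    using C by (auto simp: gs_def clone_def proj_def)
  then have "compose A f n gs \<in> C" using f by (auto simp: stabilizer_def gs_def)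
  moreover have "compose A f n gs = (n, f)"
  proof -
    have "map (\<lambda>g. g x) gs = x" if "x \<in> tuples A n" for x
      using that by (auto simp: gs_def proj_def tuples_def intro: nth_equalityI)
    then show ?thesis using op by (auto simp: compose_def is_op_def)
  qed
  ultimately show ?thesis by simp
qed

text \<open>By associativity, composing \<open>f(fs)\<close> with \<open>gs\<close> amounts to
  composing each member of \<open>fs\<close> with \<open>gs\<close>, which stays in
  \<open>C\<close>, and then applying \<open>f\<close>.\<close>

lemma clone_stabilizer:
  assumes C: "clone A C"
  shows "clone A (stabilizer A C n)"
  unfolding clone_def
proof (intro conjI allI impI)
  show "stabilizer A C n \<subseteq> Ops A" by (auto simp: stabilizer_def)
next
  fix m i :: nat assume "0 < m \<and> i < m"
  then have "proj A m i \<in> C" using C by (simp add: clone_def)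
  then show "proj A m i \<in> stabilizer A C n" using clone_subset_stabilizer[OF C] by (rule rev_subsetD)
next
  fix q f m fs
  assume *: "(q, f) \<in> stabilizer A C n \<and> length fs = q \<and> (\<forall>g\<in>set fs. (m, g) \<in> stabilizer A C n)"
  have ops: "is_op A q f" "\<And>g. g \<in> set fs \<Longrightarrow> is_op A m g"
    using * by (auto simp: stabilizer_def Ops_def)
  have "compose A (snd (compose A f m fs)) n gs \<in> C"
    if gs: "length gs = m" "\<forall>g\<in>set gs. (n, g) \<in> C" for gs
  proof -
    let ?hs = "map (\<lambda>g. snd (compose A g n gs)) fs"
    have "(n, snd (compose A g n gs)) \<in> C" if "g \<in> set fs" for g
    proof -
      have "(m, g) \<in> stabilizer A C n" using * that by blast
      then have "compose A g n gs \<in> C" using gs by (simp add: stabilizer_def)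
      then show ?thesis by (simp add: compose_def)
    qed
    then have "\<forall>h\<in>set ?hs. (n, h) \<in> C" by simp
    then have "compose A f n ?hs \<in> C"
      using * unfolding stabilizer_def by simp
    moreover have "compose A f n ?hs = compose A (snd (compose A f m fs)) n gs"
    proof -
      have "map (\<lambda>g. g x) gs \<in> tuples A m" if "x \<in> tuples A n" for x
        using map_apply_in_tuples[of gs, OF _ that] clone_is_op[OF C] gs by blast
      then show ?thesis by (simp add: compose_def comp_def cong: if_cong)
    qed
    ultimately show ?thesis by simp
  qed
  moreover have "is_op A m (snd (compose A f m fs))"
    using compose_is_op[OF ops(1) _ ops(2)] * by simp
  ultimately show "compose A f m fs \<in> stabilizer A C n"
    by (simp add: stabilizer_def Ops_def compose_def)
qed

text \<open>Dummy variables make the \<open>n\<close>-ary operations \<open>m\<close>-ary; after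
  \<open>f\<close> is applied, \<open>?\<rho>\<close> replaces the extra variables by variable 0,
  which exists as \<open>0 < n\<close>, and the \<open>n\<close>-ary composition is
  recovered.\<close>

lemma stabilizer_antimono:
  assumes C: "clone A C" and nm: "0 < n" "n \<le> m"
  shows "stabilizer A C m \<subseteq> stabilizer A C n"
proof clarify
  fix q f assume f: "(q, f) \<in> stabilizer A C m"
  have op: "is_op A q f" using f by (simp add: stabilizer_def Ops_def)
  have "compose A f n gs \<in> C" if gs: "length gs = q" "\<forall>g\<in>set gs. (n, g) \<in> C" for gs
  proof -
    let ?hs = "map (minor A m id n) gs" and ?\<rho> = "\<lambda>p. if p < n then p else 0"
    have "\<forall>h\<in>set ?hs. (m, h) \<in> C"
      using gs(2) nm by (auto intro!: clone_minor[OF C])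
    then have "compose A f m ?hs \<in> C"
      using f gs(1) by (auto simp: stabilizer_def)
    then have "(m, snd (compose A f m ?hs)) \<in> C" by (simp add: compose_def)
    then have "(n, minor A n ?\<rho> m (snd (compose A f m ?hs))) \<in> C"
      using nm by (intro clone_minor[OF C]) auto
    moreover have "minor A n ?\<rho> m (snd (compose A f m ?hs)) x = snd (compose A f n gs) x" for x
    proof (cases "x \<in> tuples A n")
      case True
      let ?y = "map (\<lambda>p. x ! ?\<rho> p) [0..<m]"
      have y: "?y \<in> tuples A m" using nm by (intro map_nth_in_tuples[OF True]) auto
      have "map (\<lambda>p. ?y ! id p) [0..<n] = x"
        using True nm by (intro nth_equalityI) (auto simp: tuples_def)
      then have "minor A m id n g ?y = g x" for g
        unfolding minor_def if_P[OF y] by (rule arg_cong)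
      then have "map (\<lambda>h. h ?y) ?hs = map (\<lambda>g. g x) gs"
        by (simp only: map_map comp_def)
      then have "snd (compose A f m ?hs) ?y = snd (compose A f n gs) x"
        by (simp only: compose_def snd_conv if_P[OF True] if_P[OF y])
      then show ?thesis by (simp only: minor_def if_P[OF True])
    qed (simp add: minor_def compose_def)
    then have "minor A n ?\<rho> m (snd (compose A f m ?hs)) = snd (compose A f n gs)" by (rule ext)
    ultimately have "(n, snd (compose A f n gs)) \<in> C" by (simp only:)
    then show ?thesis by (simp add: compose_def)
  qed
  then show "(q, f) \<in> stabilizer A C n" using op by (auto simp: stabilizer_def Ops_def)
qed

text \<open>The stabilizers for \<open>n = 1, 2, ...\<close> are descending clones above
  \<open>C\<close>, so they contain its edge operation and become constant from some
  \<open>n\<close> on. An operation in this last one lies in the stabilizer of its own arity, hence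
  in \<open>C\<close>.\<close>

lemma clone_with_edge_is_Pol:
  assumes A: "finite A" and k: "1 < k" and C: "C \<in> clones_with_edge A k"
  shows "\<exists>m R. is_rel A m R \<and> C = Pol A {(m, R)}"
proof -
  have clone: "clone A C" using C by (simp add: clones_with_edge_def)
  have stab: "stabilizer A C n \<in> clones_with_edge A k" for n
    using C clone_stabilizer[OF clone] clone_subset_stabilizer[OF clone, of n]
    unfolding clones_with_edge_def by auto
  let ?r = "{(D, E). D \<in> clones_with_edge A k \<and> E \<in> clones_with_edge A k \<and> D \<subset> E}"
  have "wf ?r"
    unfolding wf_iff_no_infinite_down_chain
  proof (intro notI, elim exE)
    fix c assume "\<forall>i. (c (Suc i), c i) \<in> ?r"
    then show False using clones_with_edge_dcc[OF A k, of c] by blast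
  qed
  then obtain D where "D \<in> stabilizer A C ` {0<..}"
    and D: "\<And>E. (E, D) \<in> ?r \<Longrightarrow> E \<notin> stabilizer A C ` {0<..}"
    by (rule wfE_min[where x = "stabilizer A C 1" and Q = "stabilizer A C ` {0<..}"]) auto
  then obtain n where n: "0 < n" "D = stabilizer A C n" by auto
  have stable: "stabilizer A C m = stabilizer A C n" if "n \<le> m" for m
  proof -
    have "\<not> stabilizer A C m \<subset> stabilizer A C n"
      using D[of "stabilizer A C m"] stab n that by auto
    then show ?thesis using stabilizer_antimono[OF clone n(1) that] by blast
  qed
  have "stabilizer A C n \<subseteq> C"
  proof clarify
    fix q f assume f: "(q, f) \<in> stabilizer A C n"
    then have "0 < q" by (auto simp: stabilizer_def Ops_def is_op_def)
    then have "(q, f) \<in> stabilizer A C q"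
      using f stable[of q] stabilizer_antimono[OF clone, of q n] by (cases "n \<le> q") auto
    then show "(q, f) \<in> C" by (rule stabilizer_same_arity[OF clone])
  qed
  then have eq: "C = stabilizer A C n" using clone_subset_stabilizer[OF clone] by blast
  obtain ws where ws: "set ws = tuples A n" using finite_list[OF finite_tuples[OF A]] by blast
  have "is_rel A (length ws) ((\<lambda>g. map g ws) ` {g. (n, g) \<in> C})"
    using clone_is_op[OF clone] ws by (fastforce simp: is_rel_def tuples_def is_op_def)
  then show ?thesis using eq stabilizer_eq_Pol[OF clone ws] by metis
qed

theorem theorem6p2:
  fixes A :: "'a set" and k :: nat
  assumes "finite A" and "k > 1"
  shows "(\<forall>C \<in> clones_with_edge A k. \<exists>m R. is_rel A m R \<and> C = Pol A {(m, R)})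
       \<and> \<not> (\<exists>c :: nat \<Rightarrow> (nat \<times> ('a list \<Rightarrow> 'a)) set.
              (\<forall>i. c i \<in> clones_with_edge A k) \<and> (\<forall>i. c (Suc i) \<subset> c i))
       \<and> countable (clones_with_edge A k)"
proof (intro conjI)
  show rel: "\<forall>C \<in> clones_with_edge A k. \<exists>m R. is_rel A m R \<and> C = Pol A {(m, R)}"
    using clone_with_edge_is_Pol[OF assms] by blast
  show "\<not> (\<exists>c :: nat \<Rightarrow> (nat \<times> ('a list \<Rightarrow> 'a)) set.
              (\<forall>i. c i \<in> clones_with_edge A k) \<and> (\<forall>i. c (Suc i) \<subset> c i))"
    using clones_with_edge_dcc[OF assms] by blast
  \<comment> \<open>As \<open>A\<close> is finite, there are finitely many relations of each arity,
    hence countably many clones \<open>Pol A {p}\<close>.\<close>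
  have "clones_with_edge A k \<subseteq> (\<lambda>p. Pol A {p}) ` (SIGMA m:UNIV. Pow (tuples A m))"
    using rel by (fastforce simp: is_rel_def)
  moreover have "countable (SIGMA m:(UNIV :: nat set). Pow (tuples A m))"
    using finite_tuples[OF assms(1)] by (intro countable_SIGMA) (auto intro: countable_finite)
  ultimately show "countable (clones_with_edge A k)"
    by (meson countable_image countable_subset)
qed

end
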